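(* Let $L$ be a rational pce language with local growth rate $\gamma_L$. If the local growth rate of every quotient of $L$ exists, then the carry propagation $\mathsf{CP}_L$ exists and is equal to $\displaystyle\frac{\gamma_L}{\gamma_L-1}$.
   Context: $A=\{0,1,\ldots,r-1\}$ is a finite alphabet with its natural order, $A^*$ is the set of words over $A$, and $|w|$ is the length of a word $w$. A language over $A$ is any subset of $A^*$; it is rational if it is accepted by a finite automaton. The radix order on $A^*$: $v$ is less than $w$ if $|v|<|w|$, or if $|v|=|w|$ and $v$ is lexicographically less than $w$. A language $L\subseteq A^*$ is a pce language if it is prefix-closed (every prefix of a word of $L$ is in $L$) and right extendable (every word of $L$ is a strict prefix of another word of $L$). An infinite language $L$ is enumerated in increasing radix order as $w_0,w_1,w_2,\ldots$. For words $u,v$: if $|u|=|v|$, $\Delta(u,v)$ is $|u|$ minus the length of the longest common prefix of $u$ and $v$; if $|u|\neq|v|$, $\Delta(u,v)=\max(|u|,|v|)$. Set $\mathsf{cp}_L(i)=\Delta(w_i,w_{i+1})$. The carry propagation of $L$ is the limit, if it exists, $\mathsf{CP}_L=\lim_{N\to\infty}\frac1N\sum_{i=0}^{N-1}\mathsf{cp}_L(i)$. For any language $K\subseteq A^*$, $\mathbf{u}_K(\ell)$ is the number of words of $K$ of length $\ell$, and the local growth rate of $K$ is the limit, if it exists, $\gamma_K=\lim_{\ell\to\infty}\mathbf{u}_K(\ell+1)/\mathbf{u}_K(\ell)$. For $w\in A^*$, the quotient of $L$ by $w$ is the language $w^{-1}L=\{v\in A^*: wv\in L\}$.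
   Formalization: The formal theorem assumes that the local growth rate of L is not 1, where the stated value is undefined (for L = 0* the carry propagation does not exist), and asks for local growth rates of the nonempty quotients only. *)

theory Defs
  imports
    Complex_Main
    "HOL-Library.Sublist"
    "HOL-Library.Infinite_Set"
    "HOL-Library.List_Lenlexorder"
begin

text \<open>
  The alphabet with \<open>r\<close> letters is \<^term>\<open>{..<r} :: nat set\<close>, words are lists of letters, and the
  set of all words over it is \<^term>\<open>lists {..<r} :: nat list set\<close>. The order on lists is the radix
  order, by its instance in \<^theory>\<open>HOL-Library.List_Lenlexorder\<close>.
\<close>

inductive fa_path :: "(nat \<times> nat \<times> nat) set \<Rightarrow> nat \<Rightarrow> nat list \<Rightarrow> nat \<Rightarrow> bool"
  for E :: "(nat \<times> nat \<times> nat) set" where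
  fa_path_Nil: "fa_path E p [] p"
| fa_path_Cons: "(p, a, q) \<in> E \<Longrightarrow> fa_path E q w s \<Longrightarrow> fa_path E p (a # w) s"

text \<open>Acceptance by a finite, possibly nondeterministic, automaton with states \<open>Q\<close>, initial states
  \<open>I\<close>, final states \<open>T\<close> and labelled transitions \<open>E\<close>. Taking states in \<^typ>\<open>nat\<close> loses no
  generality, as \<open>Q\<close> is finite.\<close>

definition rational :: "nat \<Rightarrow> nat list set \<Rightarrow> bool" where
  "rational r L \<longleftrightarrow>
     (\<exists>Q I T E. finite Q \<and> I \<subseteq> Q \<and> T \<subseteq> Q \<and> E \<subseteq> Q \<times> {..<r} \<times> Q \<and>
        L = {w. \<exists>p\<in>I. \<exists>q\<in>T. fa_path E p w q})"

definition prefix_closed :: "'a list set \<Rightarrow> bool" where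
  "prefix_closed L \<longleftrightarrow> (\<forall>w\<in>L. \<forall>v. prefix v w \<longrightarrow> v \<in> L)"

definition right_extendable :: "'a list set \<Rightarrow> bool" where
  "right_extendable L \<longleftrightarrow> (\<forall>w\<in>L. \<exists>v\<in>L. strict_prefix w v)"

definition pce :: "nat \<Rightarrow> nat list set \<Rightarrow> bool" where
  "pce r L \<longleftrightarrow> L \<subseteq> lists {..<r} \<and> prefix_closed L \<and> right_extendable L"

definition Delta :: "'a list \<Rightarrow> 'a list \<Rightarrow> nat" where
  "Delta u v =
     (if length u = length v then length u - length (longest_common_prefix u v)
      else max (length u) (length v))"

text \<open>\<^term>\<open>enumerate L i\<close> is the word \<open>w\<^sub>i\<close> of the enumeration of \<open>L\<close> in increasing radix order. Over
  a finite alphabet it reaches every word of \<open>L\<close>, although the radix order on all lists of naturals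
  is not of order type \<open>\<omega>\<close>.\<close>

lemma range_enumerate_radix:
  fixes L :: "nat list set"
  assumes inf: "infinite L" and sub: "L \<subseteq> lists {..<r}"
  shows "range (enumerate L) = L"
proof
  show "range (enumerate L) \<subseteq> L"
    using enumerate_in_set[OF inf] by blast
  show "L \<subseteq> range (enumerate L)"
  proof
    fix w assume w: "w \<in> L"
    show "w \<in> range (enumerate L)"
    proof (rule ccontr)
      assume not_in: "w \<notin> range (enumerate L)"
      have less: "enumerate L n < w" for n
      proof (induction n)
        case 0
        have "enumerate L 0 \<le> w"
          unfolding enumerate_0 by (rule Least_le) (rule w)
        with not_in show ?case by (metis order_le_less rangeI)
      next
        case (Suc n)
        have "enumerate L (Suc n) \<le> w"
          unfolding enumerate_Suc''[OF inf] by (rule Least_le) (use w Suc in auto)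
        with not_in show ?case by (metis order_le_less rangeI)
      qed
      have "range (enumerate L) \<subseteq> {v. set v \<subseteq> {..<r} \<and> length v \<le> length w}"
      proof clarify
        fix n
        have "enumerate L n \<in> lists {..<r}"
          using sub enumerate_in_set[OF inf] by blast
        moreover have "length (enumerate L n) \<le> length w"
          using less[of n] lenlex_length unfolding list_less_def by blast
        ultimately show "set (enumerate L n) \<subseteq> {..<r} \<and> length (enumerate L n) \<le> length w"
          by auto
      qed
      then have "finite (range (enumerate L))"
        by (rule finite_subset) (rule finite_lists_length_le, simp)
      moreover have "strict_mono (enumerate L)"
        using enumerate_mono[OF _ inf] by (rule strict_monoI)
      ultimately show False
        using range_inj_infinite strict_mono_imp_inj_on by blast
    qed
  qed
qed

definition cp :: "nat list set \<Rightarrow> nat \<Rightarrow> nat" where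
  "cp L i = Delta (enumerate L i) (enumerate L (Suc i))"

definition has_carry_propagation :: "nat list set \<Rightarrow> real \<Rightarrow> bool" where
  "has_carry_propagation L c \<longleftrightarrow>
     (\<lambda>N. (1 / real N) * (\<Sum>i<N. real (cp L i))) \<longlonglongrightarrow> c"

definition num_words :: "'a list set \<Rightarrow> nat \<Rightarrow> nat" where
  "num_words K l = card {w \<in> K. length w = l}"

text \<open>The first conjunct states that the ratios are eventually defined; without it, \<open>x / 0 = 0\<close> would
  give finite languages, among them the empty one, the growth rate \<open>0\<close>.\<close>

definition has_local_growth_rate :: "'a list set \<Rightarrow> real \<Rightarrow> bool" where
  "has_local_growth_rate K \<gamma> \<longleftrightarrow>
     (\<forall>\<^sub>F l in sequentially. num_words K l \<noteq> 0) \<and>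
     (\<lambda>l. real (num_words K (Suc l)) / real (num_words K l)) \<longlonglongrightarrow> \<gamma>"

text \<open>For prefix-closed \<open>L\<close> the quotient is empty exactly when \<open>w \<notin> L\<close>, and an empty quotient has no
  growth rate; hypotheses on the growth of quotients therefore concern the nonempty ones.\<close>

definition left_quotient :: "'a list \<Rightarrow> 'a list set \<Rightarrow> 'a list set" where
  "left_quotient w L = {v. w @ v \<in> L}"

end

theory Submission
  imports Defs
begin

text \<open>
  View \<open>L\<close> as a tree: the parent of a nonempty word is the word without its last letter. As \<open>L\<close> is
  prefix-closed, the parent of \<open>w\<^sub>n\<close> is some \<open>w\<^bsub>p(n)\<^esub>\<close>, and as \<open>L\<close> is right extendable, no word
  lies strictly between the parents of two consecutive words. Deleting the last letters of two
  distinct words lowers \<^const>\<open>Delta\<close> by exactly one. Hence the sum \<open>S(n)\<close> of the first \<open>n\<close> carries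
  satisfies \<open>S(n) = n + S(p(n))\<close> (lemma \<open>sum_cp_parent\<close>). If \<open>p(n) / n\<close> tends to
  \<open>\<beta> = 1 / \<gamma> < 1\<close>, this recursion forces \<open>S(n) / n\<close> to tend to \<open>1 / (1 - \<beta>) = \<gamma> / (\<gamma> - 1)\<close>
  (lemma \<open>recursive_sum_average\<close>). Here \<open>\<gamma> > 1\<close>: every word of \<open>L\<close> has an extension by one
  letter, so \<open>u\<^sub>L\<close> is nondecreasing, and \<open>\<gamma> \<noteq> 1\<close> by assumption.

  It remains to see that \<open>n / p(n)\<close> tends to \<open>\<gamma>\<close>. The words that precede a word \<open>w\<close> are the shorter
  words of \<open>L\<close> and, for each prefix \<open>x a\<close> of \<open>w\<close> and each letter \<open>b < a\<close>, the words that start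
  with \<open>x b\<close> and have the length of \<open>w\<close>. Thus \<open>p(n)\<close> is a sum of terms \<open>u\<^sub>K(m)\<close>, in which \<open>K\<close> runs
  through quotients of \<open>L\<close> and each \<open>m\<close> occurs a bounded number of times. Up to a bounded amount,
  \<open>n\<close> is the same sum with \<open>u\<^sub>K(m + 1)\<close> in place of \<open>u\<^sub>K(m)\<close>, so it suffices to control
  \<open>u\<^sub>K(m + 1) - \<gamma> u\<^sub>K(m)\<close>. If \<open>K\<close> has growth rate \<open>\<gamma>\<close>, its absolute value is at most
  \<open>\<epsilon> u\<^sub>K(m)\<close> for large \<open>m\<close>. No quotient grows faster than \<open>L\<close>, so otherwise the growth rate is
  smaller than \<open>\<gamma>\<close> and the absolute value is at most \<open>C d\<^sup>m\<close> with \<open>d < \<gamma>\<close>. Both bounds hold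
  uniformly because a rational language has finitely many quotients. Summing up gives
  \<open>\<bar>n - \<gamma> p(n)\<bar> \<le> \<epsilon> p(n) + B d\<^sup>k\<close> with \<open>k\<close> the length of the parent, and the last term
  is negligible against \<open>p(n)\<close>, which is at least \<open>u\<^sub>L(k - 1)\<close>, hence at least \<open>c f\<^sup>k\<close> for an \<open>f\<close> between
  \<open>d\<close> and \<open>\<gamma>\<close> (lemma \<open>parent_asymptotic\<close>).
\<close>

section \<open>Radix order and carries\<close>

lemma longest_common_prefix_snoc:
  assumes "length x = length y" "x @ [a] \<noteq> y @ [b]"
  shows "longest_common_prefix (x @ [a]) (y @ [b]) = longest_common_prefix x y"
  using assms by (induction x y rule: list_induct2) auto

text \<open>The identity behind the recursion for sums of carries. It also covers words of different
  lengths, and a pair of the empty word and a single letter, where both truncations are empty.\<close>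

lemma Delta_butlast:
  assumes "u \<noteq> v"
  shows "Delta u v = Suc (Delta (butlast u) (butlast v))"
proof (cases "length u = length v")
  case True
  with assms have ne: "u \<noteq> []" "v \<noteq> []" by auto
  define x y where "x = butlast u" and "y = butlast v"
  have uv: "u = x @ [last u]" "v = y @ [last v]"
    using ne by (simp_all add: x_def y_def)
  have len: "length x = length y" using True by (simp add: x_def y_def)
  have "longest_common_prefix u v = longest_common_prefix x y"
    using longest_common_prefix_snoc[OF len, of "last u" "last v"] uv assms by metis
  moreover have "length (longest_common_prefix x y) \<le> length x"
    by (simp add: longest_common_prefix_prefix1 prefix_length_le)
  moreover have "length u = Suc (length x)" using uv(1) by (metis length_append_singleton)
  ultimately show ?thesis
    using True len unfolding Delta_def x_def[symmetric] y_def[symmetric] by simp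
next
  case False
  then show ?thesis by (cases u; cases v) (auto simp: Delta_def max_def)
qed

lemma Delta_self [simp]: "Delta u u = 0"
proof -
  have "longest_common_prefix u u = u" by (induction u) auto
  then show ?thesis by (simp add: Delta_def)
qed

lemma radix_less_iff:
  fixes u v :: "'a::order list"
  shows "u < v \<longleftrightarrow> length u < length v \<or> length u = length v \<and> (u, v) \<in> lex {(a, b). a < b}"
  by (simp add: list_less_def lenlex_conv)

lemma radix_less_Cons:
  fixes u v :: "'a::order list"
  assumes "length u = length v"
  shows "a # u < b # v \<longleftrightarrow> a < b \<or> a = b \<and> u < v"
  using assms by (auto simp: radix_less_iff)

text \<open>This holds only because the order compares lengths first: in the pure lexicographic order,
  \<open>[0]\<close> precedes \<open>[0, 1]\<close>, which precedes \<open>[1]\<close>, while the truncations are \<open>[]\<close>, \<open>[0]\<close>, \<open>[]\<close>.\<close>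

lemma radix_butlast_mono:
  fixes u v :: "'a::linorder list"
  assumes "u \<le> v"
  shows "butlast u \<le> butlast v"
proof (rule ccontr)
  assume "\<not> butlast u \<le> butlast v"
  then have less: "butlast v < butlast u" by simp
  have "v < u"
  proof (cases "length (butlast v) < length (butlast u)")
    case True
    then show ?thesis unfolding radix_less_iff length_butlast by linarith
  next
    case False
    with less have len: "length (butlast v) = length (butlast u)"
      and lex: "(butlast v, butlast u) \<in> lex {(a, b). a < b}"
      by (auto simp: radix_less_iff)
    then have ne: "butlast u \<noteq> []" "butlast v \<noteq> []" by auto
    then have "u = butlast u @ [last u]" "v = butlast v @ [last v]"
      by (metis append_butlast_last_id butlast.simps(1))+
    moreover have "(butlast v @ [last v], butlast u @ [last u]) \<in> lex {(a, b). a < b}"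
      using lex by (rule lex_append_rightI) simp
    ultimately show ?thesis
      using len by (metis length_append_singleton radix_less_iff)
  qed
  with assms show False by simp
qed

definition rank :: "nat list set \<Rightarrow> nat list \<Rightarrow> nat" where
  "rank L w = card {v \<in> L. v < w}"

definition lex_below :: "nat list set \<Rightarrow> nat list \<Rightarrow> nat" where
  "lex_below K w = card {v \<in> K. length v = length w \<and> v < w}"

lemma finite_words_of_length:
  assumes "K \<subseteq> lists {..<r::nat}"
  shows "finite {v \<in> K. length v = l \<and> P v}"
  by (rule finite_subset[OF _ finite_lists_length_eq[of "{..<r}" l]]) (use assms in auto)

lemma finite_words_below:
  assumes "K \<subseteq> lists {..<r::nat}"
  shows "finite {v \<in> K. v < w}"
  by (rule finite_subset[OF _ finite_lists_length_le[of "{..<r}" "length w"]])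
    (use assms in \<open>auto simp: radix_less_iff\<close>)

lemma lex_below_Nil: "lex_below K [] = 0"
  by (auto simp: lex_below_def radix_less_iff)

text \<open>A word of the same length as \<open>a # w\<close> that precedes it either starts with a smaller letter,
  and is then arbitrary after it, or starts with \<open>a\<close> and precedes \<open>w\<close> after it.\<close>

lemma lex_below_Cons:
  assumes K: "K \<subseteq> lists {..<r}"
  shows "lex_below K (a # w) =
    (\<Sum>b<a. num_words (left_quotient [b] K) (length w)) + lex_below (left_quotient [a] K) w"
proof -
  define A where "A b = {v \<in> left_quotient [b] K. length v = length w}" for b
  define B where "B = {v \<in> left_quotient [a] K. length v = length w \<and> v < w}"
  have sub: "left_quotient [b] K \<subseteq> lists {..<r}" for b
    using K by (auto simp: left_quotient_def)
  have finA: "finite (A b)" for b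
    unfolding A_def using finite_words_of_length[OF sub, where P = "\<lambda>_. True"] by simp
  have finB: "finite B"
    unfolding B_def by (rule finite_words_of_length[OF sub])
  have eq: "{v \<in> K. length v = length (a # w) \<and> v < a # w} =
      (\<Union>b<a. (#) b ` A b) \<union> (#) a ` B" (is "?l = ?r")
  proof
    show "?l \<subseteq> ?r"
    proof
      fix v assume v: "v \<in> ?l"
      then obtain b x where "v = b # x" by (cases v) auto
      with v have bx: "b # x \<in> K" "length x = length w" "b < a \<or> b = a \<and> x < w"
        by (auto simp: radix_less_Cons)
      then have "b < a \<and> x \<in> A b \<or> b = a \<and> x \<in> B"
        by (auto simp: A_def B_def left_quotient_def)
      with \<open>v = b # x\<close> show "v \<in> ?r" by blast
    qed
    show "?r \<subseteq> ?l"
      by (auto simp: A_def B_def left_quotient_def radix_less_Cons)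
  qed
  have "lex_below K (a # w) = card (\<Union>b<a. (#) b ` A b) + card ((#) a ` B)"
    unfolding lex_below_def eq by (rule card_Un_disjoint) (use finA finB in auto)
  also have "card (\<Union>b<a. (#) b ` A b) = (\<Sum>b<a. card ((#) b ` A b))"
    by (rule card_UN_disjoint) (use finA in auto)
  also have "\<dots> = (\<Sum>b<a. num_words (left_quotient [b] K) (length w))"
    by (simp add: card_image num_words_def A_def)
  also have "card ((#) a ` B) = lex_below (left_quotient [a] K) w"
    by (simp add: card_image lex_below_def B_def)
  finally show ?thesis .
qed

lemma rank_by_length:
  assumes L: "L \<subseteq> lists {..<r}"
  shows "rank L w = (\<Sum>j<length w. num_words L j) + lex_below L w"
proof -
  define A where "A j = {v \<in> L. length v = j}" for j
  define B where "B = {v \<in> L. length v = length w \<and> v < w}"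
  have finA: "finite (A j)" for j
    unfolding A_def using finite_words_of_length[OF L, where P = "\<lambda>_. True"] by simp
  have finB: "finite B"
    unfolding B_def by (rule finite_words_of_length[OF L])
  have "{v \<in> L. v < w} = (\<Union>j<length w. A j) \<union> B"
    by (auto simp: A_def B_def radix_less_iff)
  then have "rank L w = card (\<Union>j<length w. A j) + card B"
    unfolding rank_def by (simp, intro card_Un_disjoint) (use finA finB in \<open>auto simp: A_def B_def\<close>)
  also have "card (\<Union>j<length w. A j) = (\<Sum>j<length w. card (A j))"
    by (rule card_UN_disjoint) (use finA in \<open>auto simp: A_def\<close>)
  finally show ?thesis by (simp add: A_def B_def num_words_def lex_below_def)
qed

section \<open>Sums of carries\<close>

text \<open>With prefix closure, a strict extension can be shortened to an extension by one letter.\<close>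

lemma right_extendable_step:
  assumes "prefix_closed L" "right_extendable L" "w \<in> L"
  obtains a where "w @ [a] \<in> L"
proof -
  obtain v where v: "v \<in> L" "strict_prefix w v"
    using assms by (auto simp: right_extendable_def)
  then obtain a x where "v = w @ a # x" by (auto elim: strict_prefixE')
  then have "prefix (w @ [a]) v" by (simp add: prefix_def)
  with v assms(1) that show ?thesis unfolding prefix_closed_def by blast
qed

locale pce_language =
  fixes r :: nat and L :: "nat list set"
  assumes pce: "pce r L" and nonempty: "L \<noteq> {}"
begin

lemma words: "L \<subseteq> lists {..<r}"
  and pref: "prefix_closed L"
  and ext: "right_extendable L"
  using pce by (auto simp: pce_def)

lemma Nil_in: "[] \<in> L"
  using pref nonempty unfolding prefix_closed_def by auto

lemma butlast_in: "w \<in> L \<Longrightarrow> butlast w \<in> L"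
  using pref prefixeq_butlast unfolding prefix_closed_def by blast

lemma infinite_L: "infinite L"
proof
  assume fin: "finite L"
  \<comment> \<open>A longest word of \<open>L\<close> would have an extension that is longer still.\<close>
  define w where "w = (ARG_MAX length w. w \<in> L)"
  have w: "w \<in> L" "\<And>v. v \<in> L \<Longrightarrow> length v \<le> length w"
  proof -
    have b: "\<forall>v. v \<in> L \<longrightarrow> length v \<le> Max (length ` L)" using fin by auto
    have *: "is_arg_max length (\<lambda>w. w \<in> L) w"
      unfolding w_def
      using arg_max_nat_lemma[of "\<lambda>w. w \<in> L" "[]" length "Suc (Max (length ` L))"] Nil_in b
      by (auto simp: is_arg_max_linorder less_Suc_eq_le)
    then show "w \<in> L" "\<And>v. v \<in> L \<Longrightarrow> length v \<le> length w"
      by (auto simp: is_arg_max_linorder)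
  qed
  obtain a where "w @ [a] \<in> L" using right_extendable_step[OF pref ext w(1)] .
  from w(2)[OF this] show False by simp
qed

abbreviation nth_word :: "nat \<Rightarrow> nat list" where "nth_word \<equiv> enumerate L"

lemma nth_word_in: "nth_word n \<in> L" using enumerate_in_set[OF infinite_L] .

lemma nth_word_mono: "strict_mono nth_word"
  using enumerate_mono[OF _ infinite_L] by (rule strict_monoI)

lemma range_nth_word: "range nth_word = L" by (rule range_enumerate_radix[OF infinite_L words])

lemma rank_nth_word: "rank L (nth_word n) = n"
proof -
  have "{v \<in> L. v < nth_word n} = {v \<in> range nth_word. v < nth_word n}" using range_nth_word by simp
  also have "\<dots> = nth_word ` {..<n}" using strict_mono_less[OF nth_word_mono] by auto
  finally have "{v \<in> L. v < nth_word n} = nth_word ` {..<n}" .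
  then show ?thesis
    by (simp add: rank_def card_image strict_mono_imp_inj_on[OF nth_word_mono] inj_on_subset)
qed

lemma nth_word_rank: "w \<in> L \<Longrightarrow> nth_word (rank L w) = w"
  using range_nth_word rank_nth_word by (metis imageE)

text \<open>The parent of the empty word, which has index \<open>0\<close>, is itself.\<close>

definition parent :: "nat \<Rightarrow> nat" where "parent n = rank L (butlast (nth_word n))"

lemma nth_word_parent: "nth_word (parent n) = butlast (nth_word n)"
  unfolding parent_def by (rule nth_word_rank) (rule butlast_in[OF nth_word_in])

lemma nth_word_0: "nth_word 0 = []"
proof -
  have "rank L [] = 0" by (auto simp: rank_def radix_less_iff)
  then show ?thesis using nth_word_rank[OF Nil_in] by simp
qed

lemma parent_0: "parent 0 = 0"
  using nth_word_parent[of 0] nth_word_0 strict_mono_eq[OF nth_word_mono] by (metis butlast.simps(1))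

lemma parent_less:
  assumes "n > 0" shows "parent n < n"
proof -
  have "nth_word n \<noteq> []" using assms nth_word_0 strict_mono_eq[OF nth_word_mono] by (metis less_numeral_extra(3))
  then have "nth_word (parent n) < nth_word n"
    unfolding nth_word_parent radix_less_iff by (cases "nth_word n" rule: rev_cases) auto
  then show ?thesis using strict_mono_less[OF nth_word_mono] by blast
qed

text \<open>A word \<open>x\<close> of \<open>L\<close> strictly between the parents of two consecutive words has an extension
  \<open>x a\<close> in \<open>L\<close>, and since truncation is monotone, \<open>x a\<close> would lie strictly between the two words.\<close>

lemma parent_Suc: "parent (Suc n) = parent n \<or> parent (Suc n) = Suc (parent n)"
proof (rule ccontr)
  assume neg: "\<not> ?thesis"
  have "nth_word n \<le> nth_word (Suc n)" using strict_mono_less_eq[OF nth_word_mono] by simp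
  then have "nth_word (parent n) \<le> nth_word (parent (Suc n))"
    unfolding nth_word_parent by (rule radix_butlast_mono)
  then have "parent n \<le> parent (Suc n)" using strict_mono_less_eq[OF nth_word_mono] by blast
  with neg have lt: "Suc (parent n) < parent (Suc n)" by simp
  define x where "x = nth_word (Suc (parent n))"
  have x: "nth_word (parent n) < x" "x < nth_word (parent (Suc n))"
    using lt strict_mono_less[OF nth_word_mono] by (simp_all add: x_def)
  obtain a where a: "x @ [a] \<in> L"
    using right_extendable_step[OF pref ext nth_word_in] unfolding x_def by blast
  then obtain m where m: "nth_word m = x @ [a]" using range_nth_word by (metis imageE)
  have "nth_word n < nth_word m"
    using radix_butlast_mono[of "nth_word m" "nth_word n"] x(1) m
    by (metis butlast_snoc leD leI nth_word_parent)
  moreover have "nth_word m < nth_word (Suc n)"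
    using radix_butlast_mono[of "nth_word (Suc n)" "nth_word m"] x(2) m
    by (metis butlast_snoc leD leI nth_word_parent)
  ultimately show False using strict_mono_less[OF nth_word_mono] by (metis not_less_eq)
qed

text \<open>Each carry is one more than the difference of the two parents. These are equal, and
  contribute nothing, or consecutive, and contribute a carry between earlier words. As \<open>n\<close> grows,
  each such pair of consecutive parents is met exactly once.\<close>

lemma sum_cp_parent: "(\<Sum>i<n. cp L i) = n + (\<Sum>i<parent n. cp L i)"
proof (induction n)
  case 0
  then show ?case by (simp add: parent_0)
next
  case (Suc n)
  have "nth_word n \<noteq> nth_word (Suc n)" using strict_mono_eq[OF nth_word_mono, of n "Suc n"] by simp
  then have "cp L n = Suc (Delta (nth_word (parent n)) (nth_word (parent (Suc n))))"
    unfolding cp_def nth_word_parent by (rule Delta_butlast)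
  moreover have "Delta (nth_word (parent n)) (nth_word (parent (Suc n))) + (\<Sum>i<parent n. cp L i)
      = (\<Sum>i<parent (Suc n). cp L i)"
    using parent_Suc[of n]
  proof
    assume "parent (Suc n) = parent n"
    then show ?thesis by simp
  next
    assume "parent (Suc n) = Suc (parent n)"
    then show ?thesis by (simp add: cp_def)
  qed
  ultimately show ?case using Suc by simp
qed

lemma num_words_mono: "num_words L l \<le> num_words L (Suc l)"
proof -
  let ?A = "\<lambda>l. {w \<in> L. length w = l}"
  have "?A l \<subseteq> butlast ` ?A (Suc l)"
  proof
    fix w assume w: "w \<in> ?A l"
    then obtain a where "w @ [a] \<in> L" using right_extendable_step[OF pref ext] by blast
    with w show "w \<in> butlast ` ?A (Suc l)"
      by (intro image_eqI[of _ _ "w @ [a]"]) auto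
  qed
  moreover have "finite (?A (Suc l))"
    using finite_words_of_length[OF words, of "Suc l" "\<lambda>_. True"] by simp
  ultimately show ?thesis unfolding num_words_def
    by (metis (no_types, lifting) card_image_le card_mono finite_imageI le_trans)
qed

lemma length_nth_word_at_top: "filterlim (\<lambda>n. length (nth_word n)) at_top sequentially"
proof -
  have "\<forall>\<^sub>F n in sequentially. k \<le> length (nth_word n)" for k
  proof -
    have "finite {w \<in> L. length w \<le> k}"
      by (rule finite_subset[OF _ finite_lists_length_le[of "{..<r}" k]]) (use words in auto)
    then have "finite (nth_word -` {w \<in> L. length w \<le> k})"
      by (rule finite_vimageI) (rule strict_mono_imp_inj_on[OF nth_word_mono])
    then obtain m where m: "\<And>n. n \<in> nth_word -` {w \<in> L. length w \<le> k} \<Longrightarrow> n < m"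
      by (meson finite_nat_bounded lessThan_iff subsetD)
    show ?thesis
      unfolding eventually_sequentially
    proof (intro exI allI impI)
      fix n assume "m \<le> n"
      then have "n \<notin> nth_word -` {w \<in> L. length w \<le> k}" using m by fastforce
      then show "k \<le> length (nth_word n)" using nth_word_in[of n] by simp
    qed
  qed
  then show ?thesis by (simp add: filterlim_at_top)
qed

end

section \<open>Finitely many quotients\<close>

lemma fa_path_append:
  "fa_path E p (u @ v) s \<longleftrightarrow> (\<exists>q. fa_path E p u q \<and> fa_path E q v s)"
proof (induction u arbitrary: p)
  case Nil
  have "fa_path E p [] q \<Longrightarrow> q = p" for q by (erule fa_path.cases) auto
  then show ?case by (auto intro: fa_path_Nil)
next
  case (Cons a u)
  have "fa_path E p (a # x) t \<longleftrightarrow> (\<exists>q. (p, a, q) \<in> E \<and> fa_path E q x t)" for x t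
    by (auto intro: fa_path_Cons elim: fa_path.cases)
  with Cons.IH show ?case by auto
qed

lemma fa_path_state:
  assumes "fa_path E p w q" "E \<subseteq> Q \<times> A \<times> Q" "p \<in> Q"
  shows "q \<in> Q"
  using assms by induction auto

text \<open>A quotient by \<open>w\<close> is determined by the set of states that reading \<open>w\<close> can reach.\<close>

lemma rational_finite_quotients:
  assumes "rational r L"
  shows "finite (range (\<lambda>w. left_quotient w L))"
proof -
  obtain Q I T E where Q: "finite Q" "I \<subseteq> Q" "E \<subseteq> Q \<times> {..<r} \<times> Q"
    and L: "L = {w. \<exists>p\<in>I. \<exists>q\<in>T. fa_path E p w q}"
    using assms unfolding rational_def by blast
  define R where "R w = {q. \<exists>p\<in>I. fa_path E p w q}" for w
  define F where "F X = {v. \<exists>q\<in>X. \<exists>t\<in>T. fa_path E q v t}" for X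
  have "left_quotient w L = F (R w)" for w
    by (auto simp: left_quotient_def L F_def R_def fa_path_append)
  moreover have "R w \<in> Pow Q" for w
    using fa_path_state[OF _ Q(3)] Q(2) by (auto simp: R_def)
  ultimately have "range (\<lambda>w. left_quotient w L) \<subseteq> F ` Pow Q" by auto
  then show ?thesis using Q(1) by (meson finite_Pow_iff finite_imageI finite_subset)
qed

lemma left_quotient_append:
  "left_quotient v (left_quotient w L) = left_quotient (w @ v) L"
  by (simp add: left_quotient_def)

lemma left_quotient_Nil [simp]: "left_quotient [] L = L"
  by (simp add: left_quotient_def)

lemma left_quotient_words: "L \<subseteq> lists A \<Longrightarrow> left_quotient w L \<subseteq> lists A"
  by (auto simp: left_quotient_def)

lemma num_words_quotient_le:
  assumes "L \<subseteq> lists {..<r::nat}"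
  shows "num_words (left_quotient w L) m \<le> num_words L (length w + m)"
  unfolding num_words_def
proof (rule card_inj_on_le[where f = "(@) w"])
  show "finite {x \<in> L. length x = length w + m}"
    using finite_words_of_length[OF assms, where P = "\<lambda>_. True"] by simp
qed (auto simp: inj_on_def left_quotient_def)

section \<open>Growth of a language and of its quotients\<close>

text \<open>The error bound without division, so that it can be summed over several languages.\<close>

lemma growth_rate_error:
  fixes \<delta> e :: real
  assumes rate: "has_local_growth_rate K \<delta>" and e: "e > 0"
  obtains M where "\<And>m. m \<ge> M \<Longrightarrow> num_words K m > 0"
    and "\<And>m. m \<ge> M \<Longrightarrow>
      \<bar>real (num_words K (Suc m)) - \<delta> * num_words K m\<bar> \<le> e * num_words K m"
proof -
  have "\<forall>\<^sub>F m in sequentially. num_words K m > 0 \<and>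
      \<bar>real (num_words K (Suc m)) / num_words K m - \<delta>\<bar> < e"
    using rate e unfolding has_local_growth_rate_def tendsto_iff dist_real_def
    by (intro eventually_conj) auto
  then obtain M where M: "\<And>m. m \<ge> M \<Longrightarrow> num_words K m > 0 \<and>
      \<bar>real (num_words K (Suc m)) / num_words K m - \<delta>\<bar> < e"
    unfolding eventually_sequentially by blast
  have "\<bar>real (num_words K (Suc m)) - \<delta> * num_words K m\<bar> \<le> e * num_words K m"
    if "m \<ge> M" for m
  proof -
    let ?u = "real (num_words K m)" and ?v = "real (num_words K (Suc m))"
    have u: "?u > 0" using M[OF that] by simp
    have "\<bar>?v - \<delta> * ?u\<bar> = \<bar>?v / ?u - \<delta>\<bar> * ?u"
      using u by (simp add: abs_mult_pos' field_simps flip: abs_mult_pos)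
    also have "\<dots> \<le> e * ?u" using M[OF that] u by (intro mult_right_mono) auto
    finally show ?thesis .
  qed
  with M that show ?thesis by blast
qed

lemma geometric_upper_bound:
  fixes a :: "nat \<Rightarrow> real"
  assumes d: "d > 0" and a: "\<And>m. a m \<ge> 0" and step: "\<And>m. m \<ge> M \<Longrightarrow> a (Suc m) \<le> d * a m"
  obtains C where "C \<ge> 0" "\<And>m. a m \<le> C * d ^ m"
proof
  define C where "C = (\<Sum>j\<le>M. a j / d ^ j)"
  show C0: "C \<ge> 0" unfolding C_def using a d by (intro sum_nonneg) auto
  have small: "a m \<le> C * d ^ m" if "m \<le> M" for m
  proof -
    have "a m / d ^ m \<le> C" unfolding C_def
      by (rule member_le_sum) (use that a d in auto)
    then show ?thesis using d by (simp add: field_simps)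
  qed
  have "m \<ge> M \<Longrightarrow> a m \<le> C * d ^ m" for m
  proof (induction m rule: dec_induct)
    case base
    show ?case by (rule small) simp
  next
    case (step m)
    have "a (Suc m) \<le> d * a m" using assms(3) step by simp
    also have "\<dots> \<le> d * (C * d ^ m)" using step d by simp
    finally show ?case by (simp add: mult_ac)
  qed
  with small show "a m \<le> C * d ^ m" for m by (meson nat_le_linear)
qed

lemma geometric_lower_bound:
  fixes a :: "nat \<Rightarrow> real"
  assumes d: "d > 0" and a: "a M > 0" and step: "\<And>m. m \<ge> M \<Longrightarrow> a (Suc m) \<ge> d * a m"
  obtains c where "c > 0" "\<And>m. m \<ge> M \<Longrightarrow> a m \<ge> c * d ^ m"
proof
  show "a M / d ^ M > 0" using a d by simp
  show "a m \<ge> a M / d ^ M * d ^ m" if "m \<ge> M" for m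
    using that
  proof (induction m rule: dec_induct)
    case base
    show ?case using d by simp
  next
    case (step m)
    have "a M / d ^ M * d ^ Suc m = d * (a M / d ^ M * d ^ m)" by simp
    also have "\<dots> \<le> d * a m" using step.IH d by (rule mult_left_mono[OF _ less_imp_le])
    also have "\<dots> \<le> a (Suc m)" using assms(3) step by simp
    finally show ?case .
  qed
qed

lemma growth_upper_bound:
  fixes \<delta> d :: real
  assumes "has_local_growth_rate K \<delta>" "\<delta> < d" "d > 0"
  obtains C where "C \<ge> 0" "\<And>m. num_words K m \<le> C * d ^ m"
proof -
  obtain M where "\<And>m. m \<ge> M \<Longrightarrow>
      \<bar>real (num_words K (Suc m)) - \<delta> * num_words K m\<bar> \<le> (d - \<delta>) * num_words K m"
    using growth_rate_error[OF assms(1), of "d - \<delta>"] assms(2) by (metis diff_gt_0_iff_gt)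
  then have step: "real (num_words K (Suc m)) \<le> d * num_words K m" if "m \<ge> M" for m
    using that by (force simp: algebra_simps abs_le_iff)
  show ?thesis
    using geometric_upper_bound[where a = "\<lambda>m. real (num_words K m)", OF assms(3) _ step] that
    by auto
qed

lemma growth_lower_bound:
  fixes \<delta> d :: real
  assumes "has_local_growth_rate K \<delta>" "d < \<delta>" "d > 0"
  obtains c M where "c > 0" "\<And>m. m \<ge> M \<Longrightarrow> num_words K m \<ge> c * d ^ m"
proof -
  obtain M where M: "num_words K M > 0" "\<And>m. m \<ge> M \<Longrightarrow>
      \<bar>real (num_words K (Suc m)) - \<delta> * num_words K m\<bar> \<le> (\<delta> - d) * num_words K m"
    using growth_rate_error[OF assms(1), of "\<delta> - d"] assms(2)
    by (metis diff_gt_0_iff_gt order_refl)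
  then have step: "real (num_words K (Suc m)) \<ge> d * num_words K m" if "m \<ge> M" for m
    using that by (force simp: algebra_simps abs_le_iff)
  show ?thesis
    using geometric_lower_bound[where a = "\<lambda>m. real (num_words K m)" and M = M, OF assms(3) _ step]
      M(1) that by (metis of_nat_0_less_iff)
qed

lemma geometric_dominated:
  fixes d f :: real
  assumes "0 < d" "d < f" "c > 0"
  shows "\<forall>\<^sub>F m in sequentially. C * d ^ m < c * f ^ m"
proof -
  have "(\<lambda>m. C * (d / f) ^ m) \<longlonglongrightarrow> C * 0"
    by (intro tendsto_mult tendsto_const LIMSEQ_power_zero) (use assms in auto)
  then have "\<forall>\<^sub>F m in sequentially. C * (d / f) ^ m < c"
    using order_tendstoD(2)[of _ "C * 0" _ c] assms(3) by simp
  then show ?thesis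
    by eventually_elim (use assms in \<open>simp add: power_divide field_simps\<close>)
qed

text \<open>A quotient by \<open>w\<close> has at most as many words of length \<open>m\<close> as \<open>L\<close> has of length
  \<open>m + |w|\<close>, and this shift changes a geometric bound by a constant factor only.\<close>

lemma growth_rate_quotient_le:
  fixes \<gamma> \<delta> :: real
  assumes words: "L \<subseteq> lists {..<r::nat}" and rate: "has_local_growth_rate L \<gamma>" and "\<gamma> > 0"
    and quot: "has_local_growth_rate (left_quotient w L) \<delta>"
  shows "\<delta> \<le> \<gamma>"
proof (rule ccontr)
  assume "\<not> \<delta> \<le> \<gamma>"
  then obtain d f where df: "\<gamma> < d" "d < f" "f < \<delta>"
    by (meson dense not_le)
  obtain C where C: "\<And>m. num_words L m \<le> C * d ^ m"
    using growth_upper_bound[OF rate df(1)] df \<open>\<gamma> > 0\<close> by auto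
  obtain c M where c: "c > 0" "\<And>m. m \<ge> M \<Longrightarrow> num_words (left_quotient w L) m \<ge> c * f ^ m"
    using growth_lower_bound[OF quot df(3)] df \<open>\<gamma> > 0\<close> by auto
  have "\<forall>\<^sub>F m in sequentially. (C * d ^ length w) * d ^ m < c * f ^ m"
    using geometric_dominated[of d f c] df c \<open>\<gamma> > 0\<close> by simp
  then obtain m where m: "m \<ge> M" "(C * d ^ length w) * d ^ m < c * f ^ m"
    unfolding eventually_sequentially by (meson nat_le_linear order_refl)
  have "c * f ^ m \<le> num_words L (length w + m)"
    using c(2)[OF m(1)] num_words_quotient_le[OF words, of w m] by linarith
  also have "\<dots> \<le> C * d ^ (length w + m)" by (rule C)
  finally show False using m(2) by (simp add: power_add)
qed

text \<open>A quotient that grows at the rate \<open>\<gamma>\<close> of the whole language needs only the relative error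
  for large \<open>m\<close>, and the constant \<open>C\<close> absorbs the small \<open>m\<close>. For a quotient of smaller rate the
  numbers of words are themselves below \<open>C d\<^sup>m\<close> for some \<open>d < \<gamma>\<close>.\<close>

lemma quotient_growth_error:
  fixes \<gamma> \<delta> e :: real
  assumes words: "L \<subseteq> lists {..<r::nat}" and rate: "has_local_growth_rate L \<gamma>" and \<gamma>: "\<gamma> > 1"
    and quot: "has_local_growth_rate (left_quotient w L) \<delta>" and e: "e > 0"
  shows "\<exists>C d. C \<ge> 0 \<and> 1 < d \<and> d < \<gamma> \<and> (\<forall>m.
    \<bar>real (num_words (left_quotient w L) (Suc m)) - \<gamma> * num_words (left_quotient w L) m\<bar>
      \<le> e * num_words (left_quotient w L) m + C * d ^ m)"
proof -
  let ?u = "\<lambda>m. real (num_words (left_quotient w L) m)"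
  have "\<delta> \<le> \<gamma>" using growth_rate_quotient_le[OF words rate _ quot] \<gamma> by simp
  then show ?thesis
  proof (rule order_le_imp_less_or_eq[THEN disjE])
    assume "\<delta> < \<gamma>"
    then obtain d where d: "max 1 \<delta> < d" "d < \<gamma>" using \<gamma> dense[of "max 1 \<delta>" \<gamma>] by auto
    obtain C where C: "C \<ge> 0" "\<And>m. ?u m \<le> C * d ^ m"
      using growth_upper_bound[OF quot, of d] d by auto
    have "\<bar>?u (Suc m) - \<gamma> * ?u m\<bar> \<le> e * ?u m + C * (d + \<gamma>) * d ^ m" for m
    proof -
      have "\<bar>?u (Suc m) - \<gamma> * ?u m\<bar> \<le> ?u (Suc m) + \<gamma> * ?u m"
        using \<gamma> by (simp add: abs_le_iff)
      also have "\<dots> \<le> C * d ^ Suc m + \<gamma> * (C * d ^ m)"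
        using C(2)[of "Suc m"] C(2)[of m] \<gamma> by (intro add_mono mult_left_mono) auto
      also have "\<dots> \<le> e * ?u m + C * (d + \<gamma>) * d ^ m"
        using e by (simp add: algebra_simps)
      finally show ?thesis .
    qed
    then show ?thesis using C(1) d \<gamma> by (intro exI[of _ "C * (d + \<gamma>)"] exI[of _ d]) auto
  next
    assume eq: "\<delta> = \<gamma>"
    obtain M where M: "\<And>m. m \<ge> M \<Longrightarrow> \<bar>?u (Suc m) - \<gamma> * ?u m\<bar> \<le> e * ?u m"
      using growth_rate_error[OF quot e] eq by blast
    define C where "C = (\<Sum>m<M. \<bar>?u (Suc m) - \<gamma> * ?u m\<bar>)"
    have C: "C \<ge> 0" unfolding C_def by (intro sum_nonneg) auto
    obtain d where d: "1 < d" "d < \<gamma>" using dense[OF \<gamma>] by blast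
    have "\<bar>?u (Suc m) - \<gamma> * ?u m\<bar> \<le> e * ?u m + C * d ^ m" for m
    proof (cases "m < M")
      case True
      then have "\<bar>?u (Suc m) - \<gamma> * ?u m\<bar> \<le> C"
        unfolding C_def by (intro member_le_sum[of m "{..<M}" "\<lambda>m. \<bar>?u (Suc m) - \<gamma> * ?u m\<bar>"]) auto
      also have "\<dots> \<le> C * d ^ m" using C d mult_left_mono[of 1 "d ^ m" C] by simp
      also have "\<dots> \<le> e * ?u m + C * d ^ m" using e by simp
      finally show ?thesis .
    next
      case False
      moreover have "0 \<le> C * d ^ m" using C d by simp
      ultimately show ?thesis using M[of m] by linarith
    qed
    with C d show ?thesis by blast
  qed
qed

lemma finite_uniform_error:
  fixes a b :: "'i \<Rightarrow> nat \<Rightarrow> real" and \<gamma> :: real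
  assumes "finite F" and \<gamma>: "\<gamma> > 1"
    and ex: "\<And>i. i \<in> F \<Longrightarrow> \<exists>C d. C \<ge> 0 \<and> 1 < d \<and> d < \<gamma> \<and> (\<forall>m. a i m \<le> b i m + C * d ^ m)"
  shows "\<exists>C d. C \<ge> 0 \<and> 1 < d \<and> d < \<gamma> \<and> (\<forall>i\<in>F. \<forall>m. a i m \<le> b i m + C * d ^ m)"
  using assms(1) ex
proof (induction F)
  case empty
  obtain d where "1 < d" "d < \<gamma>" using dense[OF \<gamma>] by blast
  then show ?case by (intro exI[of _ 0] exI[of _ d]) auto
next
  case (insert i F)
  obtain C d where 1: "C \<ge> 0" "1 < d" "d < \<gamma>" "\<And>m. a i m \<le> b i m + C * d ^ m"
    using insert.prems by blast
  obtain C' d' where 2: "C' \<ge> 0" "1 < d'" "d' < \<gamma>"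
      "\<And>j m. j \<in> F \<Longrightarrow> a j m \<le> b j m + C' * d' ^ m"
    using insert.IH insert.prems by blast
  have le: "C * d ^ m \<le> max C C' * max d d' ^ m" "C' * d' ^ m \<le> max C C' * max d d' ^ m" for m
    using 1 2 by (auto intro!: mult_mono power_mono)
  have "a j m \<le> b j m + max C C' * max d d' ^ m" if "j \<in> insert i F" for j m
    using that 1(4)[of m] 2(4)[of j m] le[of m] by fastforce
  then show ?case
    using 1 2 by (intro exI[of _ "max C C'"] exI[of _ "max d d'"]) auto
qed

section \<open>Index of a word and of its parent\<close>

lemma num_words_0_le: "num_words (K :: 'a list set) 0 \<le> 1"
proof -
  have "{w \<in> K. length w = 0} \<subseteq> {[]}" by auto
  then have "card {w \<in> K. length w = 0} \<le> card {[] :: 'a list}"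
    by (intro card_mono) simp_all
  then show ?thesis by (simp add: num_words_def)
qed

text \<open>Appending a letter to \<open>w\<close> moves every term of the decomposition along \<open>w\<close> one length up,
  where the growth error applies, and adds at most \<open>r\<close> words that differ from \<open>w @ [a]\<close> in the last
  letter only. The induction on \<open>w\<close> passes to quotients, hence the arbitrary \<open>x\<close>.\<close>

lemma lex_below_error:
  fixes e C d \<gamma> :: real
  assumes words: "L \<subseteq> lists {..<r}" and nonneg: "C \<ge> 0" "d > 0"
    and err: "\<And>x m. \<bar>real (num_words (left_quotient x L) (Suc m))
        - \<gamma> * num_words (left_quotient x L) m\<bar> \<le> e * num_words (left_quotient x L) m + C * d ^ m"
    and w: "w @ [a] \<in> lists {..<r}"
  shows "\<bar>real (lex_below (left_quotient x L) (w @ [a])) - \<gamma> * lex_below (left_quotient x L) w\<bar>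
    \<le> e * lex_below (left_quotient x L) w + r * C * (\<Sum>m<length w. d ^ m) + r"
  using w
proof (induction w arbitrary: x)
  case Nil
  have "real (lex_below (left_quotient x L) [a]) =
      (\<Sum>b<a. real (num_words (left_quotient (x @ [b]) L) 0))"
    by (simp add: lex_below_Cons[OF left_quotient_words[OF words]] lex_below_Nil left_quotient_append)
  also have "\<dots> \<le> (\<Sum>b<a. 1)"
    using num_words_0_le by (intro sum_mono) (simp add: of_nat_le_1_iff)
  also have "\<dots> \<le> real r" using Nil by simp
  finally show ?case by (simp add: lex_below_Nil)
next
  case (Cons c w)
  let ?u = "\<lambda>b m. real (num_words (left_quotient (x @ [b]) L) m)"
  let ?l = "\<lambda>v. real (lex_below (left_quotient (x @ [c]) L) v)"
  let ?n = "length w"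
  have split: "real (lex_below (left_quotient x L) (c # v)) = (\<Sum>b<c. ?u b (length v)) + ?l v" for v
    by (simp add: lex_below_Cons[OF left_quotient_words[OF words]] left_quotient_append)
  have c: "c \<le> r" and wa: "w @ [a] \<in> lists {..<r}" using Cons.prems by auto
  have "\<bar>(\<Sum>b<c. ?u b (Suc ?n)) - \<gamma> * (\<Sum>b<c. ?u b ?n)\<bar>
      = \<bar>\<Sum>b<c. ?u b (Suc ?n) - \<gamma> * ?u b ?n\<bar>"
    by (simp add: sum_subtractf sum_distrib_left)
  also have "\<dots> \<le> (\<Sum>b<c. e * ?u b ?n + C * d ^ ?n)"
    by (rule order_trans[OF sum_abs]) (intro sum_mono err)
  also have "\<dots> = e * (\<Sum>b<c. ?u b ?n) + c * (C * d ^ ?n)"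
    by (simp add: sum.distrib sum_distrib_left)
  also have "\<dots> \<le> e * (\<Sum>b<c. ?u b ?n) + r * (C * d ^ ?n)"
    using c nonneg by (intro add_left_mono mult_right_mono) auto
  finally have "\<bar>(\<Sum>b<c. ?u b (Suc ?n)) - \<gamma> * (\<Sum>b<c. ?u b ?n)\<bar>
      \<le> e * (\<Sum>b<c. ?u b ?n) + r * (C * d ^ ?n)" .
  moreover note Cons.IH[OF wa, of "x @ [c]"]
  ultimately show ?case
    unfolding append_Cons split by (simp add: algebra_simps)
qed

text \<open>The geometric sums of the errors are at most a constant times \<open>d ^ length w\<close> because \<open>d > 1\<close>.\<close>

lemma rank_error:
  fixes e C d \<gamma> :: real
  assumes words: "L \<subseteq> lists {..<r}" and nonneg: "C \<ge> 0" "d > 1"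
    and err: "\<And>x m. \<bar>real (num_words (left_quotient x L) (Suc m))
        - \<gamma> * num_words (left_quotient x L) m\<bar> \<le> e * num_words (left_quotient x L) m + C * d ^ m"
    and w: "w @ [a] \<in> lists {..<r}"
  shows "\<bar>real (rank L (w @ [a])) - \<gamma> * rank L w\<bar>
    \<le> e * rank L w + ((r + 1) * C / (d - 1) + r + 1) * d ^ length w"
proof -
  let ?u = "\<lambda>m. real (num_words L m)" and ?l = "\<lambda>v. real (lex_below L v)"
  let ?n = "length w"
  let ?G = "\<Sum>m<?n. d ^ m"
  have rank: "real (rank L v) = (\<Sum>j<length v. ?u j) + ?l v" for v
    by (simp add: rank_by_length[OF words])
  have rank': "real (rank L (w @ [a])) = ?u 0 + (\<Sum>j<?n. ?u (Suc j)) + ?l (w @ [a])"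
    by (simp add: rank sum.lessThan_Suc_shift del: sum.lessThan_Suc)
  have "\<bar>(\<Sum>j<?n. ?u (Suc j)) - \<gamma> * (\<Sum>j<?n. ?u j)\<bar> = \<bar>\<Sum>j<?n. ?u (Suc j) - \<gamma> * ?u j\<bar>"
    by (simp add: sum_subtractf sum_distrib_left)
  also have "\<dots> \<le> (\<Sum>j<?n. e * ?u j + C * d ^ j)"
    by (rule order_trans[OF sum_abs]) (intro sum_mono err[of "[]", simplified])
  also have "\<dots> = e * (\<Sum>j<?n. ?u j) + C * ?G"
    by (simp add: sum.distrib sum_distrib_left)
  finally have 1: "\<bar>(\<Sum>j<?n. ?u (Suc j)) - \<gamma> * (\<Sum>j<?n. ?u j)\<bar> \<le> e * (\<Sum>j<?n. ?u j) + C * ?G" .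
  have 2: "\<bar>?l (w @ [a]) - \<gamma> * ?l w\<bar> \<le> e * ?l w + r * C * ?G + r"
    using lex_below_error[OF words nonneg(1) _ err w, of "[]"] nonneg(2) by simp
  have 3: "0 \<le> ?u 0" "?u 0 \<le> 1" using num_words_0_le[of L] by simp_all
  have 4: "\<bar>real (rank L (w @ [a])) - \<gamma> * rank L w\<bar> \<le> e * rank L w + (r + 1) * C * ?G + (r + 1)"
    using 1 2 3 unfolding rank' rank[of w] by (simp add: algebra_simps abs_le_iff)
  have 5: "(r + 1) * C * ?G \<le> (r + 1) * C * (d ^ ?n / (d - 1))"
  proof (rule mult_left_mono)
    have "?G = (d ^ ?n - 1) / (d - 1)" using geometric_sum[of d ?n] nonneg(2) by simp
    also have "\<dots> \<le> d ^ ?n / (d - 1)" using nonneg(2) by (intro divide_right_mono) auto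
    finally show "?G \<le> d ^ ?n / (d - 1)" .
  qed (use nonneg in auto)
  have 6: "real (r + 1) \<le> (r + 1) * d ^ ?n"
    using nonneg(2) mult_left_mono[of 1 "d ^ ?n" "real (r + 1)"] by simp
  note 4
  also have "e * rank L w + (r + 1) * C * ?G + (r + 1)
      \<le> e * rank L w + (r + 1) * C * (d ^ ?n / (d - 1)) + (r + 1) * d ^ ?n"
    by (intro add_mono order_refl 5 6)
  also have "\<dots> = e * rank L w + ((real r + 1) * C / (d - 1) + r + 1) * d ^ ?n"
    by (simp add: distrib_right)
  finally show ?thesis .
qed

section \<open>Averages\<close>

text \<open>The candidate \<open>c = 1 / (1 - \<beta>)\<close> solves \<open>c = 1 + c \<beta>\<close>, so the error \<open>E n = S n - c n\<close>
  satisfies \<open>E n = E (p n) + c (p n - \<beta> n)\<close>. As \<open>p n\<close> is smaller than \<open>n\<close> by a constant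
  factor for large \<open>n\<close>, the accumulated errors form a geometric series and remain below \<open>e n + K\<close> for any \<open>e > 0\<close>.\<close>

lemma recursive_sum_average:
  fixes S :: "nat \<Rightarrow> real" and p :: "nat \<Rightarrow> nat" and \<beta> :: real
  assumes \<beta>: "0 \<le> \<beta>" "\<beta> < 1"
    and S: "\<And>n. S n = n + S (p n)"
    and p: "\<And>e::real. e > 0 \<Longrightarrow> \<forall>\<^sub>F n in sequentially. \<bar>real (p n) - \<beta> * real n\<bar> \<le> e * n"
  shows "(\<lambda>n. S n / n) \<longlonglongrightarrow> 1 / (1 - \<beta>)"
proof -
  define c where "c = 1 / (1 - \<beta>)"
  have c: "c > 0" "c = 1 + c * \<beta>" using \<beta> by (simp_all add: c_def field_simps)
  define E where "E n = S n - c * n" for n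
  have E_rec: "E n = E (p n) + c * (real (p n) - \<beta> * real n)" for n
  proof -
    have "E n = n + S (p n) - (1 + c * \<beta>) * n" unfolding E_def using S[of n] c(2) by simp
    then show ?thesis by (simp add: E_def algebra_simps)
  qed
  have bound: "\<exists>K. \<forall>n. \<bar>E n\<bar> \<le> e * n + K" if e: "e > 0" for e :: real
  proof -
    \<comment> \<open>The first bound on \<open>e'\<close> makes the new error fit into what the induction gains in passing
      from \<open>e * p n\<close> to \<open>e * n\<close>; the second ensures \<open>p n \<le> (1 + \<beta>) / 2 * n\<close>.\<close>
    define e' where "e' = min (e * (1 - \<beta>) / (2 * c)) ((1 - \<beta>) / 2)"
    have e': "e' > 0" "c * e' \<le> e * (1 - \<beta>) / 2" "e' \<le> (1 - \<beta>) / 2"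
    proof -
      show "e' > 0" using e \<beta> c by (simp add: e'_def)
      have "c * e' \<le> c * (e * (1 - \<beta>) / (2 * c))"
        using c by (intro mult_left_mono) (auto simp: e'_def)
      then show "c * e' \<le> e * (1 - \<beta>) / 2" using c by simp
      show "e' \<le> (1 - \<beta>) / 2" unfolding e'_def by (rule min.cobounded2)
    qed
    obtain N where N: "\<And>n. n \<ge> N \<Longrightarrow> \<bar>real (p n) - \<beta> * real n\<bar> \<le> e' * n"
      using p[OF e'(1)] unfolding eventually_sequentially by blast
    define K where "K = (\<Sum>n\<le>N. \<bar>E n\<bar>)"
    have "\<bar>E n\<bar> \<le> e * n + K" for n
    proof (induction n rule: less_induct)
      case (less n)
      show ?case
      proof (cases "n \<le> N")
        case True
        then have "\<bar>E n\<bar> \<le> K" unfolding K_def by (intro member_le_sum) auto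
        moreover have "0 \<le> e * n" using e by simp
        ultimately show ?thesis by linarith
      next
        case False
        then have n: "real n > 0" "\<bar>real (p n) - \<beta> * real n\<bar> \<le> e' * n" using N by auto
        have "e' * n \<le> (1 - \<beta>) / 2 * n" using e'(3) n(1) by (intro mult_right_mono) auto
        with n(2) have pn: "p n \<le> (1 + \<beta>) / 2 * n" by (simp add: field_simps abs_le_iff)
        also have "\<dots> < 1 * real n" using \<beta> n(1) by (intro mult_strict_right_mono) auto
        finally have "p n < n" by simp
        then have IH: "\<bar>E (p n)\<bar> \<le> e * p n + K" by (rule less.IH)
        have "\<bar>E n\<bar> \<le> \<bar>E (p n)\<bar> + c * \<bar>real (p n) - \<beta> * real n\<bar>"
          using c(1) unfolding E_rec[of n] by (simp add: abs_mult abs_triangle_ineq[THEN order_trans])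
        also have "\<dots> \<le> (e * ((1 + \<beta>) / 2 * n) + K) + c * (e' * n)"
        proof (intro add_mono mult_left_mono)
          have "e * p n \<le> e * ((1 + \<beta>) / 2 * n)" using e pn by (intro mult_left_mono) auto
          with IH show "\<bar>E (p n)\<bar> \<le> e * ((1 + \<beta>) / 2 * n) + K" by linarith
        qed (use n c in auto)
        also have "c * (e' * n) \<le> e * (1 - \<beta>) / 2 * n"
          using e'(2) n(1) mult_right_mono[of "c * e'" _ "real n"] by simp
        finally show ?thesis by (simp add: field_simps)
      qed
    qed
    then show ?thesis by blast
  qed
  have "(\<lambda>n. E n / n) \<longlonglongrightarrow> 0"
  proof (rule LIMSEQ_I)
    fix e :: real assume e: "e > 0"
    obtain K where K: "\<And>n. \<bar>E n\<bar> \<le> e / 2 * n + K" using bound[of "e / 2"] e by auto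
    obtain N where N: "real N > 2 * K / e" using reals_Archimedean2 by blast
    have "norm (E n / n - 0) < e" if "n \<ge> Suc N" for n
    proof -
      have n: "real n > 0" "real n > 2 * K / e" using that N by linarith+
      then have "K < e / 2 * n" using e by (simp add: field_simps)
      with K[of n] have "\<bar>E n\<bar> < e * n" by (simp add: field_simps)
      with n(1) show ?thesis by (simp add: field_simps)
    qed
    then show "\<exists>N. \<forall>n\<ge>N. norm (E n / n - 0) < e" by blast
  qed
  then have "(\<lambda>n. E n / n + c) \<longlonglongrightarrow> 0 + c" by (intro tendsto_add tendsto_const)
  moreover have "\<forall>\<^sub>F n in sequentially. E n / n + c = S n / n"
    using eventually_gt_at_top[of 0] by eventually_elim (simp add: E_def field_simps)
  ultimately show ?thesis unfolding c_def[symmetric] by (auto elim: Lim_transform_eventually)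
qed

section \<open>The carry propagation\<close>

context pce_language
begin

lemma growth_rate_ge_1:
  fixes \<gamma> :: real
  assumes "has_local_growth_rate L \<gamma>"
  shows "\<gamma> \<ge> 1"
proof (rule tendsto_lowerbound)
  show "(\<lambda>l. real (num_words L (Suc l)) / real (num_words L l)) \<longlonglongrightarrow> \<gamma>"
    using assms by (simp add: has_local_growth_rate_def)
  have "\<forall>\<^sub>F l in sequentially. num_words L l \<noteq> 0"
    using assms by (simp add: has_local_growth_rate_def)
  then show "\<forall>\<^sub>F l in sequentially. 1 \<le> real (num_words L (Suc l)) / real (num_words L l)"
    by eventually_elim (use num_words_mono in simp)
qed simp

text \<open>Half of \<open>e\<close> is spent on the relative error of the quotients, the other half on the
  geometric error term. The latter is outgrown by \<open>parent n\<close>, which counts among others all words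
  that are one letter shorter than the parent.\<close>

lemma parent_asymptotic:
  fixes \<gamma> e :: real
  assumes fin: "finite (range (\<lambda>w. left_quotient w L))"
    and rate: "has_local_growth_rate L \<gamma>" and \<gamma>: "\<gamma> > 1"
    and quot: "\<And>w. left_quotient w L \<noteq> {} \<Longrightarrow> \<exists>\<delta>. has_local_growth_rate (left_quotient w L) \<delta>"
    and e: "e > 0"
  shows "\<forall>\<^sub>F n in sequentially. \<bar>real n - \<gamma> * real (parent n)\<bar> \<le> e * parent n"
proof -
  have one: "\<exists>C d. C \<ge> 0 \<and> 1 < d \<and> d < \<gamma> \<and> (\<forall>m.
      \<bar>real (num_words K (Suc m)) - \<gamma> * num_words K m\<bar> \<le> e / 2 * num_words K m + C * d ^ m)"
    if K: "K \<in> range (\<lambda>w. left_quotient w L)" for K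
  proof (cases "K = {}")
    case True
    obtain d where "1 < d" "d < \<gamma>" using dense[OF \<gamma>] by blast
    with True show ?thesis by (intro exI[of _ 0] exI[of _ d]) (auto simp: num_words_def)
  next
    case False
    with K obtain w \<delta> where "K = left_quotient w L" "has_local_growth_rate (left_quotient w L) \<delta>"
      using quot by blast
    then show ?thesis using quotient_growth_error[OF words rate \<gamma>, of w \<delta> "e / 2"] e by simp
  qed
  have "\<exists>C d. C \<ge> 0 \<and> 1 < d \<and> d < \<gamma> \<and> (\<forall>K\<in>range (\<lambda>w. left_quotient w L). \<forall>m.
      \<bar>real (num_words K (Suc m)) - \<gamma> * num_words K m\<bar> \<le> e / 2 * num_words K m + C * d ^ m)"
    by (rule finite_uniform_error[OF fin \<gamma>]) (rule one)
  then obtain C d where Cd: "C \<ge> 0" "1 < d" "d < \<gamma>"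
    and err: "\<And>x m. \<bar>real (num_words (left_quotient x L) (Suc m)) - \<gamma> * num_words (left_quotient x L) m\<bar>
      \<le> e / 2 * num_words (left_quotient x L) m + C * d ^ m"
    by blast
  define B where "B = (real r + 1) * C / (d - 1) + r + 1"
  obtain f where f: "d < f" "f < \<gamma>" using dense[OF Cd(3)] by blast
  obtain c M where c: "c > 0" "\<And>m. m \<ge> M \<Longrightarrow> num_words L m \<ge> c * f ^ m"
    using growth_lower_bound[OF rate f(2)] f Cd by auto
  have "\<forall>\<^sub>F m in sequentially. B * d * d ^ m < e / 2 * c * f ^ m"
    by (rule geometric_dominated) (use f Cd c e in auto)
  then obtain M' where M': "\<And>m. m \<ge> M' \<Longrightarrow> B * d * d ^ m < e / 2 * c * f ^ m"
    unfolding eventually_sequentially by blast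
  have "\<forall>\<^sub>F n in sequentially. M + M' + 2 \<le> length (nth_word n)"
    using length_nth_word_at_top by (simp add: filterlim_at_top)
  then show ?thesis
  proof eventually_elim
    case (elim n)
    \<comment> \<open>\<open>k\<close> is the greatest length of which all words are certain to precede the parent.\<close>
    define w k where "w = butlast (nth_word n)" and "k = length w - 1"
    have "nth_word n \<noteq> []" using elim by auto
    then have wn: "nth_word n = w @ [last (nth_word n)]" by (simp add: w_def)
    have k: "length w = Suc k" "k \<ge> M" "k \<ge> M'" using elim by (auto simp: w_def k_def)
    have pn: "parent n = rank L w" by (simp add: parent_def w_def)
    have n: "n = rank L (w @ [last (nth_word n)])" using rank_nth_word[of n] wn by simp
    have "w @ [last (nth_word n)] \<in> lists {..<r}" using nth_word_in[of n] words wn by auto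
    from rank_error[OF words Cd(1,2) err this]
    have "\<bar>real n - \<gamma> * real (parent n)\<bar> \<le> e / 2 * parent n + B * d ^ Suc k"
      unfolding B_def pn k(1) n[symmetric] .
    also have "B * d ^ Suc k \<le> e / 2 * (c * f ^ k)"
      using M'[OF k(3)] by (simp add: mult_ac)
    also have "\<dots> \<le> e / 2 * parent n"
    proof (rule mult_left_mono)
      have "c * f ^ k \<le> num_words L k" using c(2) k by simp
      also have "num_words L k \<le> (\<Sum>j<length w. num_words L j)"
        by (rule member_le_sum) (use k in auto)
      also have "\<dots> \<le> parent n" unfolding pn rank_by_length[OF words] by simp
      finally show "c * f ^ k \<le> parent n" by simp
    qed (use e in simp)
    finally show ?case by (simp add: algebra_simps)
  qed
qed

end

theorem theorem4p1:
  fixes r :: nat and L :: "nat list set" and \<gamma> :: real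
  assumes "rational r L"
    and "pce r L"
    and "has_local_growth_rate L \<gamma>"
    and "\<gamma> \<noteq> 1"
    and "\<And>w. w \<in> lists {..<r} \<Longrightarrow> left_quotient w L \<noteq> {} \<Longrightarrow>
               \<exists>\<delta>. has_local_growth_rate (left_quotient w L) \<delta>"
  shows "has_carry_propagation L (\<gamma> / (\<gamma> - 1))"
proof -
  have "L \<noteq> {}"
    using assms(3) by (auto simp: has_local_growth_rate_def num_words_def)
  then interpret pce_language r L
    using assms(2) by unfold_locales
  have \<gamma>: "\<gamma> > 1" using growth_rate_ge_1[OF assms(3)] assms(4) by simp
  have quot: "\<exists>\<delta>. has_local_growth_rate (left_quotient w L) \<delta>" if "left_quotient w L \<noteq> {}" for w
  proof (rule assms(5)[OF _ that])
    show "w \<in> lists {..<r}" using that words by (auto simp: left_quotient_def)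
  qed
  have parent_le: "parent n \<le> n" for n
    using parent_0 parent_less[of n] by (cases "n = 0") auto
  define S where "S n = (\<Sum>i<n. real (cp L i))" for n
  have "(\<lambda>n. S n / n) \<longlonglongrightarrow> 1 / (1 - 1 / \<gamma>)"
  proof (rule recursive_sum_average)
    show "S n = n + S (parent n)" for n
      using sum_cp_parent[of n] unfolding S_def by (metis of_nat_add of_nat_sum)
    show "\<forall>\<^sub>F n in sequentially. \<bar>real (parent n) - 1 / \<gamma> * real n\<bar> \<le> e * n" if e: "e > 0" for e :: real
    proof -
      have "\<forall>\<^sub>F n in sequentially. \<bar>real n - \<gamma> * real (parent n)\<bar> \<le> e * parent n"
        by (rule parent_asymptotic[OF rational_finite_quotients[OF assms(1)] assms(3) \<gamma> quot e])
      then show ?thesis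
      proof eventually_elim
        case (elim n)
        have "\<bar>real (parent n) - 1 / \<gamma> * real n\<bar> = \<bar>real n - \<gamma> * real (parent n)\<bar> / \<gamma>"
          using \<gamma> by (simp add: abs_if field_simps)
        also have "\<dots> \<le> \<bar>real n - \<gamma> * real (parent n)\<bar> / 1" using \<gamma> by (intro divide_left_mono) auto
        also have "\<dots> \<le> e * parent n" using elim by simp
        also have "\<dots> \<le> e * n" using parent_le[of n] e by simp
        finally show ?case .
      qed
    qed
  qed (use \<gamma> in auto)
  moreover have "1 / (1 - 1 / \<gamma>) = \<gamma> / (\<gamma> - 1)" using \<gamma> by (simp add: field_simps)
  ultimately show ?thesis by (simp add: has_carry_propagation_def S_def)
qed

end
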